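(* Let $\mathcal{H}$ be a separable complex Hilbert space, let $\{e_k\}_{k=1}^\infty$ be an orthonormal basis for $\mathcal{H}$, and let $\{f_k\}_{k=1}^\infty\in[\{e_k\}]$. If $\{\delta_k\}_{k=1}^\infty$ is an orthonormal basis for $\mathcal{H}$ such that $\{f_k\}_{k=1}^\infty\in[\{\delta_k\}]$, then $e_k=\delta_k$ for all $k\in\mathbb{N}$.
   Context: A pair $(\{f_k\}_{k=1}^\infty,\{g_k\}_{k=1}^\infty)$ of sequences in $\mathcal{H}$ is a biframe for $\mathcal{H}$ if there exist constants $A,B>0$ such that $A\|f\|^2\le\sum_{k=1}^\infty\langle f,f_k\rangle\langle g_k,f\rangle\le B\|f\|^2$ for all $f\in\mathcal{H}$ (the series converging to a real number). For an orthonormal basis $\{e_k\}_{k=1}^\infty$, $[\{e_k\}]$ denotes the set of all sequences $\{f_k\}_{k=1}^\infty$ such that $(\{e_k\}_{k=1}^\infty,\{f_k\}_{k=1}^\infty)$ is a biframe for $\mathcal{H}$. The inner product is linear in the first variable. *)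

theory Defs
  imports "HOL-Analysis.Analysis"
begin

text \<open>Complex inner product spaces. The inner product is linear in the first variable. The
  real scalar multiplication inherited from \<^class>\<open>real_normed_vector\<close> is the restriction of the
  complex one, and the inherited norm is the one induced by the inner product, so that
  the axiom \<open>cinner_self\<close> also provides positive definiteness.\<close>

class complex_inner = real_normed_vector +
  fixes scaleC :: "complex \<Rightarrow> 'a \<Rightarrow> 'a"
    and cinner :: "'a \<Rightarrow> 'a \<Rightarrow> complex"
  assumes scaleC_add_right: "scaleC a (x + y) = scaleC a x + scaleC a y"
    and scaleC_add_left: "scaleC (a + b) x = scaleC a x + scaleC b x"
    and scaleC_scaleC: "scaleC a (scaleC b x) = scaleC (a * b) x"
    and scaleC_one: "scaleC 1 x = x"
    and scaleR_scaleC: "scaleR r x = scaleC (complex_of_real r) x"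
    and cinner_add_left: "cinner (x + y) z = cinner x z + cinner y z"
    and cinner_scaleC_left: "cinner (scaleC a x) y = a * cinner x y"
    and cinner_commute: "cinner x y = cnj (cinner y x)"
    and cinner_self: "cinner x x = complex_of_real ((norm x)\<^sup>2)"

class complex_hilbert_space = complex_inner + complete_space

global_interpretation complex_vector: vector_space "scaleC :: complex \<Rightarrow> 'a \<Rightarrow> 'a::complex_inner"
  defines cspan = complex_vector.span
  by unfold_locales (rule scaleC_add_right scaleC_add_left scaleC_scaleC scaleC_one)+

instantiation complex :: complex_hilbert_space
begin

definition "scaleC a x = a * x" for a x :: complex

definition "cinner x y = x * cnj y" for x y :: complex

instance
proof
  fix a b x y z :: complex and r :: real
  show "scaleC a (x + y) = scaleC a x + scaleC a y" "scaleC (a + b) x = scaleC a x + scaleC b x"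
    by (simp_all only: scaleC_complex_def distrib_left distrib_right)
  show "scaleC a (scaleC b x) = scaleC (a * b) x" "scaleC 1 x = x"
    by (simp_all only: scaleC_complex_def mult.assoc mult_1_left)
  show "scaleR r x = scaleC (complex_of_real r) x"
    by (simp only: scaleC_complex_def scaleR_conv_of_real)
  show "cinner (x + y) z = cinner x z + cinner y z"
    by (simp only: cinner_complex_def distrib_right)
  show "cinner (scaleC a x) y = a * cinner x y"
    by (simp only: cinner_complex_def scaleC_complex_def mult.assoc)
  show "cinner x y = cnj (cinner y x)"
    by (simp only: cinner_complex_def complex_cnj_mult complex_cnj_cnj mult.commute)
  show "cinner x x = complex_of_real ((norm x)\<^sup>2)"
    by (simp only: cinner_complex_def complex_norm_square)
qed

end

text \<open>Sequences indexed by the positive integers are functions on \<^typ>\<open>nat\<close>, starting at 0.\<close>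

definition orthonormal_basis :: "(nat \<Rightarrow> 'a::complex_inner) \<Rightarrow> bool" where
  "orthonormal_basis e \<longleftrightarrow>
     (\<forall>i j. cinner (e i) (e j) = (if i = j then 1 else 0)) \<and> closure (cspan (range e)) = UNIV"

text \<open>The series need not converge absolutely: \<open>sums\<close> is convergence of the partial sums.\<close>

definition biframe :: "(nat \<Rightarrow> 'a::complex_inner) \<Rightarrow> (nat \<Rightarrow> 'a) \<Rightarrow> bool" where
  "biframe f g \<longleftrightarrow>
     (\<exists>A B :: real. A > 0 \<and> B > 0 \<and>
       (\<forall>x. \<exists>s::real. (\<lambda>k. cinner x (f k) * cinner (g k) x) sums complex_of_real s \<and>
          A * (norm x)\<^sup>2 \<le> s \<and> s \<le> B * (norm x)\<^sup>2))"

definition biframe_class :: "(nat \<Rightarrow> 'a::complex_inner) \<Rightarrow> (nat \<Rightarrow> 'a) set" where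
  "biframe_class e = {f. biframe e f}"

end

theory Submission
  imports Defs
begin

text \<open>A biframe \<open>(e, f)\<close> yields the bounded coercive Hermitian form
  \<open>B x y = (\<Sum>k. \<langle>x, e k\<rangle> \<langle>f k, y\<rangle>)\<close>, with \<open>B (e k) y = \<langle>f k, y\<rangle>\<close>. If \<open>B'\<close> is the form of
  \<open>(\<delta>, f)\<close> and \<open>U\<close> is the isometry with \<open>U (e k) = \<delta> k\<close>, then \<open>B x y = B' (U x) y\<close>; since both
  forms are Hermitian, \<open>U\<close> is symmetric with respect to \<open>B'\<close>. The bounded sequence
  \<open>B' (U\<^sup>n x) (U\<^sup>n x)\<close> has second differences \<open>B' (U\<^sup>n y) (U\<^sup>n y)\<close> with \<open>y = U\<^sup>2 x - x\<close>, which are at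
  least a positive multiple of \<open>\<parallel>y\<parallel>\<^sup>2\<close>; hence \<open>y = 0\<close> and \<open>U\<^sup>2 = I\<close>. Finally \<open>y = U x - x\<close> satisfies
  \<open>U y = - y\<close>, so that \<open>B y y = - B' y y\<close> forces \<open>y = 0\<close>.\<close>

subsection \<open>Complex inner products\<close>

lemma cinner_add_right: "cinner x (y + z) = cinner x y + cinner x z"
  unfolding cinner_commute[of x] by (simp add: cinner_add_left)

lemma cinner_scaleC_right: "cinner x (scaleC a y) = cnj a * cinner x y"
  unfolding cinner_commute[of x] by (simp add: cinner_scaleC_left)

lemma cinner_diff_left: "cinner (x - y) z = cinner x z - cinner y z"
  using cinner_add_left[of "x - y" y z] by simp

lemma cinner_diff_right: "cinner x (y - z) = cinner x y - cinner x z"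
  using cinner_add_right[of x "y - z" z] by simp

lemma cinner_zero_left [simp]: "cinner 0 y = 0"
  using cinner_diff_left[of 0 0 y] by simp

lemma cinner_zero_right [simp]: "cinner y 0 = 0"
  using cinner_diff_right[of y 0 0] by simp

lemma cinner_sum_left: "cinner (sum g A) y = (\<Sum>k\<in>A. cinner (g k) y)"
  by (induction A rule: infinite_finite_induct) (simp_all add: cinner_add_left)

lemma cinner_sum_right: "cinner y (sum g A) = (\<Sum>k\<in>A. cinner y (g k))"
  by (induction A rule: infinite_finite_induct) (simp_all add: cinner_add_right)

lemma norm_scaleC: "norm (scaleC a x) = cmod a * norm (x :: 'a::complex_inner)"
proof -
  have "complex_of_real ((norm (scaleC a x))\<^sup>2) = a * cnj a * cinner x x"
    by (simp only: cinner_self[symmetric] cinner_scaleC_left cinner_scaleC_right mult_ac)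
  also have "\<dots> = complex_of_real ((cmod a * norm x)\<^sup>2)"
    by (simp add: cinner_self power_mult_distrib flip: complex_norm_square)
  finally have "(norm (scaleC a x))\<^sup>2 = (cmod a * norm x)\<^sup>2"
    using of_real_eq_iff by blast
  then show ?thesis
    by (simp add: power2_eq_iff_nonneg)
qed

subsection \<open>Expansions in an orthonormal basis\<close>

text \<open>For \<open>d = e\<close> this is a partial Fourier sum. In general it is a partial sum
  of the isometry carrying each \<open>e k\<close> to \<open>d k\<close>; the sum for
  \<open>n = 0\<close> is empty.\<close>

definition partial_transfer :: "(nat \<Rightarrow> 'a::complex_inner) \<Rightarrow> (nat \<Rightarrow> 'a) \<Rightarrow> nat \<Rightarrow> 'a \<Rightarrow> 'a" where
  "partial_transfer e d n x = (\<Sum>k<n. scaleC (cinner x (e k)) (d k))"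

text \<open>\<open>lim\<close> is unspecified on divergent sequences; convergence comes from
  completeness once both systems are orthonormal bases.\<close>

definition transfer_basis :: "(nat \<Rightarrow> 'a::complex_inner) \<Rightarrow> (nat \<Rightarrow> 'a) \<Rightarrow> 'a \<Rightarrow> 'a" where
  "transfer_basis e d x = lim (\<lambda>n. partial_transfer e d n x)"

lemma orthonormal_basisD:
  "orthonormal_basis e \<Longrightarrow> cinner (e i) (e j) = (if i = j then 1 else 0)"
  by (simp add: orthonormal_basis_def)

lemma norm_orthonormal_sum:
  assumes "orthonormal_basis e" "finite A"
  shows "(norm (\<Sum>k\<in>A. scaleC (c k) (e k)))\<^sup>2 = (\<Sum>k\<in>A. (cmod (c k))\<^sup>2)"
proof -
  have "complex_of_real ((norm (\<Sum>k\<in>A. scaleC (c k) (e k)))\<^sup>2)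
      = (\<Sum>k\<in>A. \<Sum>j\<in>A. if k = j then c k * cnj (c j) else 0)"
    unfolding cinner_self[symmetric] cinner_sum_left cinner_sum_right
    by (intro sum.cong refl)
      (simp add: cinner_scaleC_left cinner_scaleC_right orthonormal_basisD[OF assms(1)])
  also have "\<dots> = (\<Sum>k\<in>A. c k * cnj (c k))"
    using assms(2) by simp
  also have "\<dots> = complex_of_real (\<Sum>k\<in>A. (cmod (c k))\<^sup>2)"
    by (simp only: complex_norm_square of_real_sum)
  finally show ?thesis
    using of_real_eq_iff by blast
qed

text \<open>The partial sum \<open>p\<close> is an orthogonal projection of \<open>x\<close>:
  \<open>cinner x p\<close> equals the squared norm of \<open>p\<close>, which makes Pythagoras
  applicable to \<open>x - p\<close> and \<open>p\<close>.\<close>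

lemma Bessel:
  assumes "orthonormal_basis e"
  shows "norm (partial_transfer e e n x) \<le> norm x"
proof -
  define p where "p = partial_transfer e e n x"
  have "cinner x p = (\<Sum>k<n. cnj (cinner x (e k)) * cinner x (e k))"
    by (simp add: p_def partial_transfer_def cinner_sum_right cinner_scaleC_right)
  also have "\<dots> = complex_of_real (\<Sum>k<n. (cmod (cinner x (e k)))\<^sup>2)"
    by (simp only: complex_norm_square of_real_sum mult.commute)
  also have "(\<Sum>k<n. (cmod (cinner x (e k)))\<^sup>2) = (norm p)\<^sup>2"
    by (simp add: p_def partial_transfer_def norm_orthonormal_sum[OF assms])
  finally have xp: "cinner x p = complex_of_real ((norm p)\<^sup>2)" .
  then have px: "cinner p x = complex_of_real ((norm p)\<^sup>2)"
    by (subst cinner_commute) simp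
  have "complex_of_real ((norm (x - p))\<^sup>2) = complex_of_real ((norm x)\<^sup>2 - (norm p)\<^sup>2)"
    by (simp only: cinner_self[symmetric] cinner_diff_left cinner_diff_right xp px)
      (simp add: cinner_self)
  then have "(norm (x - p))\<^sup>2 = (norm x)\<^sup>2 - (norm p)\<^sup>2"
    using of_real_eq_iff by blast
  then have "(norm p)\<^sup>2 \<le> (norm x)\<^sup>2"
    using zero_le_power2[of "norm (x - p)"] by linarith
  then show ?thesis
    by (simp add: p_def power2_le_iff_abs_le)
qed

lemma partial_transfer_add:
  "partial_transfer e d n (x + y) = partial_transfer e d n x + partial_transfer e d n y"
  by (simp add: partial_transfer_def cinner_add_left scaleC_add_left sum.distrib)

lemma partial_transfer_scaleC:
  "partial_transfer e d n (scaleC a x) = scaleC a (partial_transfer e d n x)"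
  by (simp add: partial_transfer_def cinner_scaleC_left scaleC_scaleC
      complex_vector.scale_sum_right)

lemma partial_transfer_diff:
  "partial_transfer e d n (x - y) = partial_transfer e d n x - partial_transfer e d n y"
  using partial_transfer_add[of e d n "x - y" y] by simp

lemma partial_transfer_basis:
  assumes "orthonormal_basis e" "k < n"
  shows "partial_transfer e d n (e k) = d k"
proof -
  have "partial_transfer e d n (e k) = (\<Sum>j<n. if k = j then d j else 0)"
    unfolding partial_transfer_def
    by (intro sum.cong refl) (simp add: orthonormal_basisD[OF assms(1)] scaleC_one)
  then show ?thesis
    using assms(2) by simp
qed

lemma eventually_partial_transfer_cspan:
  assumes "orthonormal_basis e" "x \<in> cspan (range e)"
  shows "\<forall>\<^sub>F n in sequentially. partial_transfer e e n x = x"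
  using assms(2)
proof (induction rule: complex_vector.span_induct_alt)
  case base
  then show ?case by (simp add: partial_transfer_def)
next
  case (step c z y)
  then obtain k where z: "z = e k" by blast
  have "\<forall>\<^sub>F n in sequentially. partial_transfer e e n z = z"
    using eventually_gt_at_top[of k]
    by eventually_elim (simp add: z partial_transfer_basis[OF assms(1)])
  with step.IH show ?case
    by eventually_elim (simp add: partial_transfer_add partial_transfer_scaleC)
qed

text \<open>Expansions of vectors in the span are eventually exact. Bessel makes the partial sums
  contractive uniformly in \<open>n\<close>, so density of the span extends convergence to every
  \<open>x\<close>.\<close>

lemma orthonormal_expansion:
  assumes "orthonormal_basis e"
  shows "(\<lambda>n. partial_transfer e e n x) \<longlonglongrightarrow> x"
proof (rule tendstoI)
  fix r :: real
  assume "r > 0"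
  moreover have "x \<in> closure (cspan (range e))"
    using assms by (simp add: orthonormal_basis_def)
  ultimately obtain v where v: "v \<in> cspan (range e)" "dist v x < r / 2"
    unfolding closure_approachable by (meson half_gt_zero)
  show "\<forall>\<^sub>F n in sequentially. dist (partial_transfer e e n x) x < r"
    using eventually_partial_transfer_cspan[OF assms v(1)]
  proof eventually_elim
    case (elim n)
    have "dist (partial_transfer e e n x) x = norm (partial_transfer e e n (x - v) + (v - x))"
      using elim by (simp add: dist_norm partial_transfer_diff)
    also have "\<dots> \<le> norm (x - v) + norm (v - x)"
      using Bessel[OF assms, of n "x - v"] norm_triangle_ineq order_trans add_right_mono by meson
    also have "\<dots> < r"
      using v(2) by (simp add: dist_norm norm_minus_commute)
    finally show ?case .
  qed
qed

text \<open>The norm of a block of terms depends only on the coefficients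
  \<open>cinner x (e k)\<close>, not on the orthonormal system they multiply. This carries the
  Cauchy property from \<open>e\<close> to \<open>d\<close>.\<close>

lemma norm_partial_transfer_diff:
  assumes "orthonormal_basis e" "orthonormal_basis d"
  shows "norm (partial_transfer e d m x - partial_transfer e d n x)
    = norm (partial_transfer e e m x - partial_transfer e e n x)"
proof -
  have eq: "(norm (partial_transfer e h m x - partial_transfer e h n x))\<^sup>2
      = (\<Sum>k\<in>{n..<m}. (cmod (cinner x (e k)))\<^sup>2)"
    if "n \<le> m" "orthonormal_basis h" for h and m n :: nat
  proof -
    have "partial_transfer e h m x - partial_transfer e h n x
        = (\<Sum>k\<in>{n..<m}. scaleC (cinner x (e k)) (h k))"
      unfolding partial_transfer_def lessThan_atLeast0 by (rule sum_diff_nat_ivl) (use that in auto)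
    then show ?thesis
      by (simp add: norm_orthonormal_sum that)
  qed
  have le: "norm (partial_transfer e d m x - partial_transfer e d n x)
      = norm (partial_transfer e e m x - partial_transfer e e n x)" if "n \<le> m" for m n :: nat
    using eq[OF that assms(1)] eq[OF that assms(2)] by (metis norm_ge_zero power2_eq_iff_nonneg)
  show ?thesis
    using le[of n m] le[of m n] by (metis nat_le_linear norm_minus_commute)
qed

lemma partial_transfer_LIMSEQ:
  fixes e d :: "nat \<Rightarrow> 'a::complex_hilbert_space"
  assumes "orthonormal_basis e" "orthonormal_basis d"
  shows "(\<lambda>n. partial_transfer e d n x) \<longlonglongrightarrow> transfer_basis e d x"
proof -
  have "Cauchy (\<lambda>n. partial_transfer e e n x)"
    using orthonormal_expansion[OF assms(1)] LIMSEQ_imp_Cauchy by blast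
  then have "Cauchy (\<lambda>n. partial_transfer e d n x)"
    unfolding Cauchy_def dist_norm norm_partial_transfer_diff[OF assms] .
  then show ?thesis
    unfolding transfer_basis_def
    using Cauchy_convergent convergent_LIMSEQ_iff by blast
qed

lemma norm_transfer_basis:
  fixes e d :: "nat \<Rightarrow> 'a::complex_hilbert_space"
  assumes "orthonormal_basis e" "orthonormal_basis d"
  shows "norm (transfer_basis e d x) = norm x"
proof -
  have "norm (partial_transfer e d n x) = norm (partial_transfer e e n x)" for n
    using norm_partial_transfer_diff[OF assms, of n x 0] by (simp add: partial_transfer_def)
  then have "(\<lambda>n. norm (partial_transfer e d n x)) \<longlonglongrightarrow> norm x"
    using tendsto_norm[OF orthonormal_expansion[OF assms(1)]] by simp
  then show ?thesis
    using tendsto_norm[OF partial_transfer_LIMSEQ[OF assms]] LIMSEQ_unique by blast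
qed

lemma transfer_basis_diff:
  fixes e d :: "nat \<Rightarrow> 'a::complex_hilbert_space"
  assumes "orthonormal_basis e" "orthonormal_basis d"
  shows "transfer_basis e d (x - y) = transfer_basis e d x - transfer_basis e d y"
proof (rule LIMSEQ_unique[OF partial_transfer_LIMSEQ[OF assms]])
  show "(\<lambda>n. partial_transfer e d n (x - y)) \<longlonglongrightarrow> transfer_basis e d x - transfer_basis e d y"
    unfolding partial_transfer_diff by (intro tendsto_diff partial_transfer_LIMSEQ[OF assms])
qed

lemma transfer_basis_basis:
  assumes "orthonormal_basis e"
  shows "transfer_basis e d (e k) = d k"
proof -
  have "\<forall>\<^sub>F n in sequentially. partial_transfer e d n (e k) = d k"
    using eventually_gt_at_top[of k]
    by eventually_elim (rule partial_transfer_basis[OF assms])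
  then show ?thesis
    unfolding transfer_basis_def by (intro limI tendsto_eventually)
qed

subsection \<open>Coercive Hermitian forms\<close>

locale coercive_form =
  fixes B :: "'a::complex_inner \<Rightarrow> 'a \<Rightarrow> complex" and a b :: real
  assumes pos: "a > 0"
    and add_left: "B (x + y) z = B x z + B y z"
    and scaleC_left: "B (scaleC c x) z = c * B x z"
    and herm: "B x y = cnj (B y x)"
    and lower: "a * (norm x)\<^sup>2 \<le> Re (B x x)"
    and upper: "Re (B x x) \<le> b * (norm x)\<^sup>2"
begin

lemma add_right: "B z (x + y) = B z x + B z y"
  unfolding herm[of z] by (simp add: add_left)

lemma diff_left: "B (x - y) z = B x z - B y z"
  using add_left[of "x - y" y z] by simp

lemma diff_right: "B z (x - y) = B z x - B z y"
  using add_right[of z "x - y" y] by simp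

lemma scaleC_right: "B z (scaleC c x) = cnj c * B z x"
  unfolding herm[of z] by (simp add: scaleC_left)

lemma sum_left: "B (sum g A) y = (\<Sum>k\<in>A. B (g k) y)"
  using diff_left[of 0 0 y]
  by (induction A rule: infinite_finite_induct) (simp_all add: add_left)

lemma nonneg: "0 \<le> Re (B x x)"
  by (rule order_trans[OF _ lower]) (use pos in simp)

lemma eq_0_if_nonpos:
  assumes "Re (B x x) \<le> 0"
  shows "x = 0"
proof -
  have "a * (norm x)\<^sup>2 \<le> 0"
    using lower[of x] assms by linarith
  then show ?thesis
    using pos by (simp add: mult_le_0_iff)
qed

text \<open>The locale puts no sign condition on \<open>b\<close>, and in the zero space
  \<open>b\<close> could be negative; hence a nonzero vector is needed.\<close>

lemma upper_nonneg:
  assumes "(x :: 'a) \<noteq> 0"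
  shows "b \<ge> 0"
proof -
  have "0 \<le> b * (norm x)\<^sup>2"
    using nonneg[of x] upper[of x] by linarith
  then show ?thesis
    using assms by (simp add: zero_le_mult_iff)
qed

text \<open>Polarization on unit vectors, then homogeneity.\<close>

lemma Re_bound: "\<bar>Re (B x y)\<bar> \<le> b * (norm x * norm y)"
proof (cases "x = 0 \<or> y = 0")
  case True
  then show ?thesis
    using diff_left[of 0 0 y] diff_right[of x 0 0] by auto
next
  case False
  define u v where "u = x /\<^sub>R norm x" and "v = y /\<^sub>R norm y"
  have uv: "norm u = 1" "norm v = 1"
    using False by (simp_all add: u_def v_def)
  have b: "b \<ge> 0"
    using False upper_nonneg by blast
  \<comment> \<open>The two quadratic values in the polarization identity lie in
    \<open>[0, 4 * b]\<close>, so their difference, which is four times \<open>Re (B u v)\<close>,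
    is at most \<open>4 * b\<close> in absolute value.\<close>
  have q: "0 \<le> Re (B z z) \<and> Re (B z z) \<le> 4 * b" if "norm z \<le> 2" for z
  proof -
    have "(norm z)\<^sup>2 \<le> 2\<^sup>2"
      using that by (intro power_mono) auto
    then have "b * (norm z)\<^sup>2 \<le> b * 4"
      using b by (intro mult_left_mono) auto
    then show ?thesis
      using nonneg[of z] upper[of z] by linarith
  qed
  have "Re (B (u + v) (u + v)) - Re (B (u - v) (u - v)) = 4 * Re (B u v)"
    using herm[of v u] by (simp add: add_left add_right diff_left diff_right)
  moreover have "norm (u + v) \<le> 2" "norm (u - v) \<le> 2"
    using norm_triangle_ineq[of u v] norm_triangle_ineq4[of u v] uv by auto
  ultimately have uvb: "\<bar>Re (B u v)\<bar> \<le> b"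
    using q[of "u + v"] q[of "u - v"] by linarith
  have "x = norm x *\<^sub>R u" "y = norm y *\<^sub>R v"
    using False by (simp_all add: u_def v_def)
  then have "B x y = complex_of_real (norm x * norm y) * B u v"
    by (metis (no_types, lifting) scaleR_scaleC scaleC_left scaleC_right complex_cnj_complex_of_real
        mult.assoc of_real_mult)
  then have "\<bar>Re (B x y)\<bar> = norm x * norm y * \<bar>Re (B u v)\<bar>"
    by (simp add: abs_mult)
  also have "\<dots> \<le> norm x * norm y * b"
    by (intro mult_left_mono uvb) auto
  finally show ?thesis
    by (simp add: mult.commute)
qed

text \<open>The imaginary part is a real part after replacing \<open>x\<close> by
  \<open>scaleC \<i> x\<close>; the factor 2 comes from adding the two bounds. The estimate serves
  to give continuity.\<close>

lemma bound: "cmod (B x y) \<le> 2 * b * norm x * norm y"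
proof -
  have "\<bar>Im (B x y)\<bar> = \<bar>Re (B (scaleC \<i> x) y)\<bar>"
    by (simp add: scaleC_left)
  also have "\<dots> \<le> b * (norm x * norm y)"
    using Re_bound[of "scaleC \<i> x" y] by (simp add: norm_scaleC)
  finally show ?thesis
    using Re_bound[of x y] cmod_le[of "B x y"] by simp
qed

lemma tendsto_left:
  assumes "z \<longlonglongrightarrow> x"
  shows "(\<lambda>n. B (z n) y) \<longlonglongrightarrow> B x y"
proof -
  have "(\<lambda>n. 2 * b * norm (z n - x) * norm y) \<longlonglongrightarrow> 0"
    by (intro tendsto_mult_left_zero tendsto_mult_right_zero tendsto_norm_zero LIM_zero assms)
  then have "(\<lambda>n. B (z n - x) y) \<longlonglongrightarrow> 0"
    by (rule Lim_null_comparison[rotated]) (simp add: bound)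
  then show ?thesis
    unfolding diff_left by (rule LIM_zero_cancel)
qed

lemma symmetric_isometry_involution:
  assumes diff: "\<And>x y. U (x - y) = U x - U y"
    and isom: "\<And>x. norm (U x) = norm x"
    and symm: "\<And>x y. B (U x) y = B x (U y)"
  shows "U (U x) = x"
proof (rule ccontr)
  assume "U (U x) \<noteq> x"
  define y where "y = U (U x) - x"
  define c where "c = a * (norm y)\<^sup>2"
  have c: "c > 0"
    using \<open>U (U x) \<noteq> x\<close> pos by (simp add: c_def y_def)
  define s where "s n = Re (B ((U ^^ n) x) ((U ^^ n) x))" for n
  have norm_pow: "norm ((U ^^ n) z) = norm z" for n z
    by (induction n) (simp_all add: isom)
  have diff_pow: "(U ^^ n) (z - w) = (U ^^ n) z - (U ^^ n) w" for n z w
    by (induction n) (simp_all add: diff)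
  have step: "s (Suc (Suc n)) - s (Suc n) \<ge> s (Suc n) - s n + c" for n
  proof -
    define z where "z = (U ^^ n) x"
    have z: "(U ^^ n) y = U (U z) - z"
      by (simp add: y_def z_def diff_pow flip: funpow_swap1)
    have "c \<le> Re (B (U (U z) - z) (U (U z) - z))"
      using lower[of "(U ^^ n) y"] unfolding c_def z[symmetric] norm_pow .
    \<comment> \<open>By symmetry of \<open>U\<close>, both cross terms \<open>B (U (U z)) z\<close>
      and \<open>B z (U (U z))\<close> equal \<open>B (U z) (U z)\<close>.\<close>
    also have "\<dots> = s (Suc (Suc n)) - 2 * s (Suc n) + s n"
      by (simp add: s_def diff_left diff_right symm flip: z_def)
    finally show ?thesis by simp
  qed
  have growth: "s (Suc n) - s n \<ge> s 1 - s 0 + of_nat n * c" for n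
  proof (induction n)
    case (Suc n)
    then show ?case
      using step[of n] by (simp add: algebra_simps)
  qed simp
  \<comment> \<open>An increment of \<open>s\<close> is at most the upper bound of \<open>s\<close>,
    since \<open>s\<close> is nonnegative, while the increments grow at least linearly; the
    Archimedean property gives the contradiction.\<close>
  have "of_nat n * c \<le> b * (norm x)\<^sup>2 + s 0" for n
  proof -
    have "s (Suc n) \<le> b * (norm x)\<^sup>2" "s n \<ge> 0" "s 1 \<ge> 0"
      unfolding s_def using upper norm_pow nonneg by metis+
    then show ?thesis
      using growth[of n] by linarith
  qed
  then show False
    using ex_less_of_nat_mult[OF c] by (meson not_less)
qed

end

subsection \<open>The form of a biframe\<close>

definition biframe_form :: "(nat \<Rightarrow> 'a::complex_inner) \<Rightarrow> (nat \<Rightarrow> 'a) \<Rightarrow> 'a \<Rightarrow> 'a \<Rightarrow> complex" where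
  "biframe_form f g x y = (\<Sum>k. cinner x (f k) * cinner (g k) y)"

text \<open>A biframe only guarantees convergence on the diagonal. Polarizing term by term writes
  the mixed series as a combination of four diagonal ones, so no absolute convergence is
  required.\<close>

lemma biframe_form_sums:
  assumes "biframe f g"
  shows "(\<lambda>k. cinner x (f k) * cinner (g k) y) sums biframe_form f g x y"
proof -
  define t where "t z k = cinner z (f k) * cinner (g k) z" for z k
  have t: "summable (t z)" for z
    using assms unfolding biframe_def t_def by (meson sums_summable)
  have "cinner x (f k) * cinner (g k) y
      = (t (x + y) k - t (x - y) k + \<i> * t (x + scaleC \<i> y) k - \<i> * t (x - scaleC \<i> y) k) / 4" for k
    by (simp add: t_def cinner_add_left cinner_add_right cinner_diff_left cinner_diff_right
        cinner_scaleC_left cinner_scaleC_right algebra_simps)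
  then have "summable (\<lambda>k. cinner x (f k) * cinner (g k) y)"
    by (simp only:) (intro summable_divide summable_diff summable_add summable_mult t)
  then show ?thesis
    unfolding biframe_form_def by (rule summable_sums)
qed

lemma coercive_biframe_form:
  assumes "biframe f g"
  obtains a b where "coercive_form (biframe_form f g) a b"
proof -
  let ?B = "biframe_form f g"
  note sums = biframe_form_sums[OF assms]
  obtain a b where a: "a > 0" and ab: "\<And>x. \<exists>s::real.
      (\<lambda>k. cinner x (f k) * cinner (g k) x) sums complex_of_real s \<and>
        a * (norm x)\<^sup>2 \<le> s \<and> s \<le> b * (norm x)\<^sup>2"
    using assms unfolding biframe_def by blast
  have diag: "Im (?B x x) = 0 \<and> a * (norm x)\<^sup>2 \<le> Re (?B x x) \<and> Re (?B x x) \<le> b * (norm x)\<^sup>2" for x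
    using ab[of x] sums[of x x] sums_unique2 by fastforce
  have add: "?B (x + y) z = ?B x z + ?B y z" for x y z
    using sums_add[OF sums[of x z] sums[of y z]] sums[of "x + y" z] sums_unique2
    by (auto simp: cinner_add_left algebra_simps)
  have add': "?B z (x + y) = ?B z x + ?B z y" for x y z
    using sums_add[OF sums[of z x] sums[of z y]] sums[of z "x + y"] sums_unique2
    by (auto simp: cinner_add_right algebra_simps)
  have scale: "?B (scaleC c x) z = c * ?B x z" for c x z
    using sums_mult[OF sums[of x z], of c] sums[of "scaleC c x" z] sums_unique2
    by (auto simp: cinner_scaleC_left algebra_simps)
  have scale': "?B z (scaleC c x) = cnj c * ?B z x" for c x z
    using sums_mult[OF sums[of z x], of "cnj c"] sums[of z "scaleC c x"] sums_unique2
    by (auto simp: cinner_scaleC_right algebra_simps)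
  \<comment> \<open>The diagonal values are real. Expanding at \<open>x + y\<close> compares the
    imaginary parts, and at \<open>x + scaleC \<i> y\<close> the real parts.\<close>
  have "?B x y = cnj (?B y x)" for x y
  proof (rule complex_eqI)
    show "Im (?B x y) = Im (cnj (?B y x))"
      using diag[of "x + y"] diag[of x] diag[of y] by (simp add: add add')
    show "Re (?B x y) = Re (cnj (?B y x))"
      using diag[of "x + scaleC \<i> y"] diag[of x] diag[of y]
      by (simp add: add add' scale scale')
  qed
  then have "coercive_form ?B a b"
    using a diag add scale by unfold_locales blast+
  then show thesis by (rule that)
qed

text \<open>Orthonormality of \<open>d\<close> reduces \<open>biframe_form d f (d k) y\<close> to
  \<open>cinner (f k) y\<close>, so on partial transfers the form of \<open>d\<close> gives the
  partial sums of the form of \<open>e\<close>. Continuity in the first argument passes to the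
  limit.\<close>

lemma biframe_form_transfer_basis:
  fixes e d :: "nat \<Rightarrow> 'a::complex_hilbert_space"
  assumes "orthonormal_basis e" "orthonormal_basis d" "biframe e f" "biframe d f"
  shows "biframe_form d f (transfer_basis e d x) y = biframe_form e f x y"
proof -
  obtain a b where "coercive_form (biframe_form d f) a b"
    using coercive_biframe_form[OF assms(4)] .
  then interpret coercive_form "biframe_form d f" a b .
  have "(\<lambda>j. cinner (d k) (d j) * cinner (f j) y) = (\<lambda>j. if j = k then cinner (f j) y else 0)" for k
    by (auto simp: orthonormal_basisD[OF assms(2)])
  then have "biframe_form d f (d k) y = cinner (f k) y" for k
    using biframe_form_sums[OF assms(4), of "d k" y] sums_single[of k "\<lambda>j. cinner (f j) y"]
    by (simp only:) (rule sums_unique2)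
  then have "biframe_form d f (partial_transfer e d n x) y
      = (\<Sum>k<n. cinner x (e k) * cinner (f k) y)" for n
    by (simp add: partial_transfer_def sum_left scaleC_left)
  then have "(\<lambda>k. cinner x (e k) * cinner (f k) y) sums
      biframe_form d f (transfer_basis e d x) y"
    using tendsto_left[OF partial_transfer_LIMSEQ[OF assms(1,2), of x], of y]
    by (simp add: sums_def)
  then show ?thesis
    using biframe_form_sums[OF assms(3)] sums_unique2 by blast
qed

theorem proposition6p3:
  fixes e f \<delta> :: "nat \<Rightarrow> 'a::complex_hilbert_space"
  assumes "separable_space (euclidean :: 'a topology)"
    and "orthonormal_basis e"
    and "f \<in> biframe_class e"
    and "orthonormal_basis \<delta>"
    and "f \<in> biframe_class \<delta>"
  shows "\<forall>k. e k = \<delta> k"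
proof
  fix k
  have bi: "biframe e f" "biframe \<delta> f"
    using assms(3,5) by (simp_all add: biframe_class_def)
  define U where "U = transfer_basis e \<delta>"
  obtain a b where "coercive_form (biframe_form e f) a b"
    using coercive_biframe_form[OF bi(1)] .
  then interpret E: coercive_form "biframe_form e f" a b .
  obtain a' b' where "coercive_form (biframe_form \<delta> f) a' b'"
    using coercive_biframe_form[OF bi(2)] .
  then interpret D: coercive_form "biframe_form \<delta> f" a' b' .
  have U: "biframe_form \<delta> f (U x) y = biframe_form e f x y" for x y
    unfolding U_def by (rule biframe_form_transfer_basis[OF assms(2,4) bi])
  have U_diff: "U (x - y) = U x - U y" for x y
    unfolding U_def by (rule transfer_basis_diff[OF assms(2,4)])
  have invol: "U (U x) = x" for x
  proof (rule D.symmetric_isometry_involution)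
    show "norm (U x) = norm x" for x
      unfolding U_def by (rule norm_transfer_basis[OF assms(2,4)])
    \<comment> \<open>Move \<open>U\<close> out of the form of \<open>\<delta>\<close>, swap the
      arguments in the form of \<open>e\<close>, and move back in the form of
      \<open>\<delta>\<close>.\<close>
    show "biframe_form \<delta> f (U x) y = biframe_form \<delta> f x (U y)" for x y
      using U[of x y] U[of y x] D.herm[of x "U y"] E.herm[of x y] by simp
  qed (rule U_diff)
  define y where "y = U (e k) - e k"
  have "U y = 0 - y"
    by (simp add: y_def U_diff invol)
  then have "biframe_form e f y y = - biframe_form \<delta> f y y"
    using U[of y y] D.diff_left[of 0 y y] D.diff_left[of 0 0 y] by simp
  then have "y = 0"
    \<comment> \<open>The form of \<open>e\<close> at \<open>(y, y)\<close> is the negative of a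
      value with nonnegative real part, so coercivity applies.\<close>
    using D.nonneg[of y] by (intro E.eq_0_if_nonpos) simp
  then show "e k = \<delta> k"
    by (simp add: y_def U_def transfer_basis_basis[OF assms(2)])
qed

end
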